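(* There exist a Boolean contact algebra $B$ with $0\neq 1$ and a topology on the set $\mathbf{W}(B)$ of all Whitehead points of $B$ such that the map $$s\colon B\to\mathcal{P}(\mathbf{W}(B)),\qquad s(x)=\{[A]\in\mathbf{W}(B)\mid \exists a\in A\ a\leq x\},$$ is an injective Boolean homomorphism of $B$ into the Boolean algebra $\mathrm{RO}(\mathbf{W}(B))$ of regular open subsets of $\mathbf{W}(B)$, and for all $x,y\in B$, $$x\mathrel{C}y\iff \mathrm{Cl}\,s(x)\cap\mathrm{Cl}\,s(y)\neq\emptyset .$$
   Context: A Boolean contact algebra is a Boolean algebra $B$ (operations $\cdot,+,-$, constants $0,1$, order $\leq$) with a binary relation $C$ (contact) such that for all $x,y,z\in B$: (C0) not $0\mathrel{C}x$; (C1) $x\leq y\wedge x\neq 0\Rightarrow x\mathrel{C}y$; (C2) $x\mathrel{C}y\Rightarrow y\mathrel{C}x$; (C3) $x\leq y\Rightarrow \forall z\,(z\mathrel{C}x\Rightarrow z\mathrel{C}y)$; (C4) $x\mathrel{C}(y+z)\Rightarrow x\mathrel{C}y\vee x\mathrel{C}z$. Non-tangential inclusion is defined by: $x\ll y$ iff not $x\mathrel{C}(-y)$. An abstractive set in $B$ is a set $A\subseteq B$ such that $0\notin A$; for all $u,v\in A$, $u=v$ or $u\ll v$ or $v\ll u$; and there is no $x\in A$ with $x\leq y$ for all $y\in A$. For abstractive sets, $A_1$ covers $A_2$ ($A_1\succeq A_2$) iff for every $x\in A_1$ there is $y\in A_2$ with $y\leq x$; $A_1\sim A_2$ iff $A_1\succeq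 A_2$ and $A_2\succeq A_1$; and $[A_1]\trianglerighteq[A_2]$ iff $A_1\succeq A_2$, where $[A]$ is the $\sim$-class of $A$. A Whitehead point of $B$ is a class $[A]$ such that for every abstractive $A'$, $[A]\trianglerighteq[A']$ implies $[A]=[A']$. $\mathbf{W}(B)$ is the set of all Whitehead points of $B$. (The set $s(x)$ does not depend on the choice of representatives $A$.) For a topological space $X$, a subset $U$ is regular open if $U=\mathrm{Int}\,\mathrm{Cl}\,U$. $\mathrm{RO}(X)$ is the Boolean algebra of regular open sets with $U\cdot V=U\cap V$, $U+V=\mathrm{Int}\,\mathrm{Cl}(U\cup V)$, $-U=\mathrm{Int}(X\setminus U)$. *)

theory Defs
  imports "HOL-Analysis.Abstract_Topology" "HOL-Library.FuncSet"
begin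

record 'a bool_alg =
  carrier :: "'a set"
  meet :: "['a, 'a] \<Rightarrow> 'a" (infixl \<open>\<sqinter>\<index>\<close> 70)
  join :: "['a, 'a] \<Rightarrow> 'a" (infixl \<open>\<squnion>\<index>\<close> 65)
  compl :: "'a \<Rightarrow> 'a" (\<open>\<sim>\<index> _\<close> [81] 80)
  bzero :: 'a (\<open>\<zero>\<index>\<close>)
  bone :: 'a (\<open>\<one>\<index>\<close>)

text \<open>The axioms of \<open>abstract_boolean_algebra\<close>, relativised to a carrier.\<close>

locale bool_algebra =
  fixes B (structure)
  assumes meet_closed [simp, intro]: "\<lbrakk>x \<in> carrier B; y \<in> carrier B\<rbrakk> \<Longrightarrow> x \<sqinter> y \<in> carrier B"
    and join_closed [simp, intro]: "\<lbrakk>x \<in> carrier B; y \<in> carrier B\<rbrakk> \<Longrightarrow> x \<squnion> y \<in> carrier B"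
    and compl_closed [simp, intro]: "x \<in> carrier B \<Longrightarrow> \<sim> x \<in> carrier B"
    and zero_closed [simp, intro]: "\<zero> \<in> carrier B"
    and one_closed [simp, intro]: "\<one> \<in> carrier B"
    and meet_assoc: "\<lbrakk>x \<in> carrier B; y \<in> carrier B; z \<in> carrier B\<rbrakk> \<Longrightarrow> (x \<sqinter> y) \<sqinter> z = x \<sqinter> (y \<sqinter> z)"
    and join_assoc: "\<lbrakk>x \<in> carrier B; y \<in> carrier B; z \<in> carrier B\<rbrakk> \<Longrightarrow> (x \<squnion> y) \<squnion> z = x \<squnion> (y \<squnion> z)"
    and meet_commute: "\<lbrakk>x \<in> carrier B; y \<in> carrier B\<rbrakk> \<Longrightarrow> x \<sqinter> y = y \<sqinter> x"
    and join_commute: "\<lbrakk>x \<in> carrier B; y \<in> carrier B\<rbrakk> \<Longrightarrow> x \<squnion> y = y \<squnion> x"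
    and meet_join_distrib: "\<lbrakk>x \<in> carrier B; y \<in> carrier B; z \<in> carrier B\<rbrakk>
          \<Longrightarrow> x \<sqinter> (y \<squnion> z) = (x \<sqinter> y) \<squnion> (x \<sqinter> z)"
    and join_meet_distrib: "\<lbrakk>x \<in> carrier B; y \<in> carrier B; z \<in> carrier B\<rbrakk>
          \<Longrightarrow> x \<squnion> (y \<sqinter> z) = (x \<squnion> y) \<sqinter> (x \<squnion> z)"
    and meet_one: "x \<in> carrier B \<Longrightarrow> x \<sqinter> \<one> = x"
    and join_zero: "x \<in> carrier B \<Longrightarrow> x \<squnion> \<zero> = x"
    and meet_compl: "x \<in> carrier B \<Longrightarrow> x \<sqinter> \<sim> x = \<zero>"
    and join_compl: "x \<in> carrier B \<Longrightarrow> x \<squnion> \<sim> x = \<one>"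

definition ble :: "[('a, 'm) bool_alg_scheme, 'a, 'a] \<Rightarrow> bool" (infixl \<open>\<sqsubseteq>\<index>\<close> 50)
  where "x \<sqsubseteq>\<^bsub>B\<^esub> y \<longleftrightarrow> x \<sqinter>\<^bsub>B\<^esub> y = x"

definition bool_hom :: "[('a, 'm) bool_alg_scheme, ('b, 'n) bool_alg_scheme] \<Rightarrow> ('a \<Rightarrow> 'b) set"
  where "bool_hom A B = {h \<in> carrier A \<rightarrow> carrier B.
    (\<forall>x\<in>carrier A. \<forall>y\<in>carrier A. h (x \<sqinter>\<^bsub>A\<^esub> y) = h x \<sqinter>\<^bsub>B\<^esub> h y) \<and>
    (\<forall>x\<in>carrier A. \<forall>y\<in>carrier A. h (x \<squnion>\<^bsub>A\<^esub> y) = h x \<squnion>\<^bsub>B\<^esub> h y) \<and>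
    (\<forall>x\<in>carrier A. h (\<sim>\<^bsub>A\<^esub> x) = \<sim>\<^bsub>B\<^esub> (h x)) \<and>
    h \<zero>\<^bsub>A\<^esub> = \<zero>\<^bsub>B\<^esub> \<and> h \<one>\<^bsub>A\<^esub> = \<one>\<^bsub>B\<^esub>}"

record 'a contact_alg = "'a bool_alg" +
  contact :: "['a, 'a] \<Rightarrow> bool" (infixl \<open>\<bowtie>\<index>\<close> 50)

locale boolean_contact_algebra = bool_algebra B
  for B :: "('a, 'm) contact_alg_scheme" (structure) +
  assumes C0: "x \<in> carrier B \<Longrightarrow> \<not> \<zero> \<bowtie> x"
    and C1: "\<lbrakk>x \<in> carrier B; y \<in> carrier B; x \<sqsubseteq> y; x \<noteq> \<zero>\<rbrakk> \<Longrightarrow> x \<bowtie> y"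
    and C2: "\<lbrakk>x \<in> carrier B; y \<in> carrier B; x \<bowtie> y\<rbrakk> \<Longrightarrow> y \<bowtie> x"
    and C3: "\<lbrakk>x \<in> carrier B; y \<in> carrier B; z \<in> carrier B; x \<sqsubseteq> y; z \<bowtie> x\<rbrakk> \<Longrightarrow> z \<bowtie> y"
    and C4: "\<lbrakk>x \<in> carrier B; y \<in> carrier B; z \<in> carrier B; x \<bowtie> (y \<squnion> z)\<rbrakk> \<Longrightarrow> x \<bowtie> y \<or> x \<bowtie> z"

definition nontangential :: "[('a, 'm) contact_alg_scheme, 'a, 'a] \<Rightarrow> bool" (infixl \<open>\<lless>\<index>\<close> 50)
  where "x \<lless>\<^bsub>B\<^esub> y \<longleftrightarrow> \<not> x \<bowtie>\<^bsub>B\<^esub> (\<sim>\<^bsub>B\<^esub> y)"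

text \<open>
  The last clause only excludes a least element, so the empty set is abstractive; a
  nonzero lower bound lying outside the set is allowed.
\<close>

definition abstractive :: "('a, 'm) contact_alg_scheme \<Rightarrow> 'a set \<Rightarrow> bool"
  where "abstractive B A \<longleftrightarrow> A \<subseteq> carrier B \<and> \<zero>\<^bsub>B\<^esub> \<notin> A \<and>
    (\<forall>u\<in>A. \<forall>v\<in>A. u = v \<or> u \<lless>\<^bsub>B\<^esub> v \<or> v \<lless>\<^bsub>B\<^esub> u) \<and>
    \<not> (\<exists>x\<in>A. \<forall>y\<in>A. x \<sqsubseteq>\<^bsub>B\<^esub> y)"

definition covers :: "('a, 'm) contact_alg_scheme \<Rightarrow> 'a set \<Rightarrow> 'a set \<Rightarrow> bool"
  where "covers B A1 A2 \<longleftrightarrow> (\<forall>x\<in>A1. \<exists>y\<in>A2. y \<sqsubseteq>\<^bsub>B\<^esub> x)"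

definition cover_equiv :: "('a, 'm) contact_alg_scheme \<Rightarrow> 'a set \<Rightarrow> 'a set \<Rightarrow> bool"
  where "cover_equiv B A1 A2 \<longleftrightarrow> covers B A1 A2 \<and> covers B A2 A1"

definition cover_class :: "('a, 'm) contact_alg_scheme \<Rightarrow> 'a set \<Rightarrow> 'a set set"
  where "cover_class B A = {A'. abstractive B A' \<and> cover_equiv B A A'}"

text \<open>
  The order on classes induced by \<open>covers\<close>; it does not depend on the representatives,
  see \<open>class_covers_iff\<close> below.
\<close>

definition class_covers :: "('a, 'm) contact_alg_scheme \<Rightarrow> 'a set set \<Rightarrow> 'a set set \<Rightarrow> bool"
  where "class_covers B P Q \<longleftrightarrow> (\<exists>A1 A2. abstractive B A1 \<and> abstractive B A2 \<and>
    P = cover_class B A1 \<and> Q = cover_class B A2 \<and> covers B A1 A2)"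

definition whitehead_points :: "('a, 'm) contact_alg_scheme \<Rightarrow> 'a set set set"
  where "whitehead_points B = {cover_class B A | A. abstractive B A \<and>
    (\<forall>A'. abstractive B A' \<longrightarrow> class_covers B (cover_class B A) (cover_class B A') \<longrightarrow>
      cover_class B A = cover_class B A')}"

definition whitehead_map :: "('a, 'm) contact_alg_scheme \<Rightarrow> 'a \<Rightarrow> 'a set set set"
  where "whitehead_map B x = {cover_class B A | A. abstractive B A \<and>
    cover_class B A \<in> whitehead_points B \<and> (\<exists>a\<in>A. a \<sqsubseteq>\<^bsub>B\<^esub> x)}"

definition regular_openin :: "'a topology \<Rightarrow> 'a set \<Rightarrow> bool"
  where "regular_openin X U \<longleftrightarrow> U = X interior_of (X closure_of U)"

definition regular_open_algebra :: "'a topology \<Rightarrow> 'a set bool_alg"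
  where "regular_open_algebra X =
    \<lparr>carrier = {U. regular_openin X U},
     meet = (\<lambda>U V. U \<inter> V),
     join = (\<lambda>U V. X interior_of (X closure_of (U \<union> V))),
     compl = (\<lambda>U. X interior_of (topspace X - U)),
     bzero = {},
     bone = topspace X\<rparr>"

context bool_algebra
begin

lemma ble_refl:
  assumes "x \<in> carrier B" shows "x \<sqsubseteq> x"
proof -
  have "x = x \<sqinter> (x \<squnion> \<sim> x)" using assms by (simp add: join_compl meet_one)
  also have "\<dots> = x \<sqinter> x"
    using assms by (simp only: meet_join_distrib compl_closed meet_compl join_zero meet_closed)
  finally show ?thesis by (simp add: ble_def)
qed

lemma ble_trans:
  assumes "x \<in> carrier B" "y \<in> carrier B" "z \<in> carrier B" "x \<sqsubseteq> y" "y \<sqsubseteq> z"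
  shows "x \<sqsubseteq> z"
  using assms unfolding ble_def by (metis meet_assoc)

end

context boolean_contact_algebra
begin

lemma covers_trans:
  assumes "A1 \<subseteq> carrier B" "A2 \<subseteq> carrier B" "A3 \<subseteq> carrier B" "covers B A1 A2" "covers B A2 A3"
  shows "covers B A1 A3"
  using assms ble_trans unfolding covers_def by (meson subsetD)

lemma cover_class_eq_iff:
  assumes "abstractive B A1" "abstractive B A2"
  shows "cover_class B A1 = cover_class B A2 \<longleftrightarrow> cover_equiv B A1 A2"
proof -
  have car: "\<And>A. abstractive B A \<Longrightarrow> A \<subseteq> carrier B" by (simp add: abstractive_def)
  have refl: "\<And>A. abstractive B A \<Longrightarrow> covers B A A"
    using car ble_refl unfolding covers_def by blast
  show ?thesis
  proof
    assume "cover_class B A1 = cover_class B A2"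
    then show "cover_equiv B A1 A2"
      using assms refl unfolding cover_class_def cover_equiv_def by blast
  next
    assume "cover_equiv B A1 A2"
    then show "cover_class B A1 = cover_class B A2"
      using assms covers_trans car unfolding cover_class_def cover_equiv_def by blast
  qed
qed

lemma class_covers_iff:
  assumes "abstractive B A1" "abstractive B A2"
  shows "class_covers B (cover_class B A1) (cover_class B A2) \<longleftrightarrow> covers B A1 A2"
proof
  assume "class_covers B (cover_class B A1) (cover_class B A2)"
  then obtain D1 D2 where D: "abstractive B D1" "abstractive B D2"
      "cover_class B A1 = cover_class B D1" "cover_class B A2 = cover_class B D2" "covers B D1 D2"
    unfolding class_covers_def by blast
  then have "covers B A1 D1" "covers B D2 A2"
    using assms cover_class_eq_iff unfolding cover_equiv_def by blast+
  with D assms show "covers B A1 A2"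
    using covers_trans unfolding abstractive_def by meson
qed (use assms in \<open>auto simp: class_covers_def\<close>)

end

lemma regular_openin_imp_openin: "regular_openin X U \<Longrightarrow> openin X U"
  unfolding regular_openin_def by (metis openin_interior_of)

lemma regular_openin_interior_closure:
  "regular_openin X (X interior_of (X closure_of S))"
  unfolding regular_openin_def
  by (intro equalityI interior_of_maximal interior_of_mono)
     (simp_all add: closure_of_minimal closure_of_subset interior_of_subset interior_of_subset_topspace)

lemma bool_algebra_regular_open_algebra: "bool_algebra (regular_open_algebra X)"
proof -
  let ?r = "\<lambda>S. X interior_of (X closure_of S)"
  have ro: "regular_openin X U \<Longrightarrow> ?r U = U" for U by (simp add: regular_openin_def)
  have mono: "S \<subseteq> T \<Longrightarrow> ?r S \<subseteq> ?r T" for S T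
    by (intro interior_of_mono closure_of_mono)
  have sub: "openin X S \<Longrightarrow> S \<subseteq> ?r S" for S
    by (intro interior_of_maximal closure_of_subset) (simp_all add: openin_subset)
  have rr: "?r (?r S) = ?r S" for S
    using regular_openin_interior_closure[of X S] ro by simp
  have rint: "?r (U \<inter> V) = ?r U \<inter> ?r V" if "openin X U" "openin X V" for U V
  proof
    show "?r (U \<inter> V) \<subseteq> ?r U \<inter> ?r V" using mono by (simp add: le_infI)
    have "?r U \<inter> ?r V \<subseteq> ?r U \<inter> X closure_of V" using interior_of_subset by fast
    also have "\<dots> \<subseteq> X closure_of (?r U \<inter> V)" by (simp add: openin_Int_closure_of_subset)
    also have "\<dots> \<subseteq> X closure_of (V \<inter> X closure_of U)"
      using interior_of_subset by (intro closure_of_mono) fast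
    also have "\<dots> \<subseteq> X closure_of (U \<inter> V)"
      using openin_Int_closure_of_subset[OF that(2), of U]
      by (intro closure_of_minimal) (simp_all add: Int_commute)
    finally show "?r U \<inter> ?r V \<subseteq> ?r (U \<inter> V)"
      by (intro interior_of_maximal) (simp_all add: openin_Int)
  qed
  have join_ro: "?r (?r S \<union> T) = ?r (S \<union> T)" if "openin X S" "openin X T" for S T
  proof
    have "?r S \<union> T \<subseteq> ?r (S \<union> T)"
      using mono[of S "S \<union> T"] sub[of "S \<union> T"] that by blast
    then show "?r (?r S \<union> T) \<subseteq> ?r (S \<union> T)" using mono rr by metis
    show "?r (S \<union> T) \<subseteq> ?r (?r S \<union> T)" using sub[OF that(1)] by (intro mono) blast
  qed
  have join_compl: "?r (U \<union> X interior_of (topspace X - U)) = topspace X" if "openin X U" for U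
  proof -
    have "topspace X - X closure_of U \<subseteq> X closure_of (topspace X - X closure_of U)"
      by (intro closure_of_subset) auto
    then have "X closure_of (U \<union> X interior_of (topspace X - U)) = topspace X"
      unfolding closure_of_Un interior_of_complement
      using closure_of_subset_topspace[of X] by blast
    then show ?thesis by simp
  qed
  have compl_ro: "regular_openin X (X interior_of (topspace X - U))" if "openin X U" for U
    using regular_openin_interior_closure[of X "topspace X - U"] that
    by (simp add: closure_of_complement interior_of_openin)
  note op = regular_openin_imp_openin
  show ?thesis
  proof (unfold_locales, goal_cases)
    case (1 U V) then show ?case
      by (auto simp: regular_open_algebra_def) (metis op rint ro regular_openin_def)
  next
    case (7 U V W)
    then have o: "openin X U" "openin X V" "openin X W"
      by (simp_all add: regular_open_algebra_def op)
    have "?r (?r (U \<union> V) \<union> W) = ?r ((U \<union> V) \<union> W)" by (intro join_ro openin_Un o)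
    also have "\<dots> = ?r ((V \<union> W) \<union> U)" by (simp only: Un_ac)
    also have "\<dots> = ?r (?r (V \<union> W) \<union> U)" by (intro join_ro[symmetric] openin_Un o)
    also have "\<dots> = ?r (U \<union> ?r (V \<union> W))" by (simp only: Un_commute)
    finally show ?case by (simp add: regular_open_algebra_def del: closure_of_Un)
  next
    case (10 U V W)
    then have "U \<inter> ?r (V \<union> W) = ?r (U \<inter> (V \<union> W))"
      by (simp add: regular_open_algebra_def rint op openin_Un ro del: closure_of_Un)
    with 10 show ?case by (simp add: regular_open_algebra_def Int_Un_distrib del: closure_of_Un)
  next
    case (11 U V W) then show ?case
      by (simp add: regular_open_algebra_def Un_Int_distrib rint op openin_Un del: closure_of_Un)
  next
    case (14 U) 
    then have "U \<subseteq> X closure_of U"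
      by (simp add: regular_open_algebra_def op openin_subset closure_of_subset)
    then show ?case by (auto simp: regular_open_algebra_def interior_of_complement)
  next
    case (12 U) then show ?case
      using openin_subset[OF op] by (auto simp: regular_open_algebra_def)
  next
    case (15 U) then show ?case
      using join_compl[OF op, of U] by (simp add: regular_open_algebra_def del: closure_of_Un)
  qed (auto simp: regular_open_algebra_def regular_openin_interior_closure compl_ro op ro Un_commute
        Int_commute Int_assoc regular_openin_def[of X "{}"] regular_openin_def[of X "topspace X"]
        simp del: closure_of_Un)
qed

end

theory Submission
  imports Defs
begin

text \<open>
  The topology may be chosen freely, so the discrete one is taken: every set of Whitehead
  points is then clopen and regular open, and closures disappear from the claim. It remains to
  find an algebra in which \<open>x \<mapsto> s(x)\<close> turns the Boolean operations into the set-theoretic ones,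
  is injective, and satisfies \<open>x\<close> in contact with \<open>y\<close> iff \<open>s(x)\<close> meets \<open>s(y)\<close>.

  With overlap (\<open>x \<inter> y \<noteq> {}\<close>) as contact on a field of sets, nontangential inclusion is plain
  inclusion, and an abstractive set is a chain of nonempty members without a least one. If below
  every nonempty member there is a Whitehead point, then each Whitehead point \<open>[A]\<close> generates
  an ultrafilter (\<open>whitehead_point_decides\<close>): were \<open>x\<close> undecided, then
  \<open>{a \<inter> x | a. a \<in> A}\<close>, or some abstractive set below its least element, would properly refine
  \<open>A\<close>. Thus \<open>s\<close> is the Stone map restricted to the ultrafilters generated by chains, and it
  preserves complements; all other requirements follow from the abundance of points.

  A field with enough points is that of the clopen subsets of the Sorgenfrey line: the sets
  whose indicator function is locally constant to the right of every real number. The intervals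
  \<open>{p..<q}\<close> with \<open>q > p\<close> form an abstractive set, and each clopen set either contains or misses
  one of them, so no abstractive set properly refines this one
  (\<open>right_germ_whitehead_point\<close>).
\<close>

section \<open>Representatives of Whitehead points\<close>

context boolean_contact_algebra
begin

lemma whitehead_point_iff:
  assumes "abstractive B A"
  shows "cover_class B A \<in> whitehead_points B \<longleftrightarrow>
    (\<forall>A'. abstractive B A' \<longrightarrow> covers B A A' \<longrightarrow> covers B A' A)"
proof -
  have "cover_class B A \<in> whitehead_points B \<longleftrightarrow>
      (\<exists>D. abstractive B D \<and> cover_class B A = cover_class B D \<and>
        (\<forall>A'. abstractive B A' \<longrightarrow> covers B D A' \<longrightarrow> cover_class B D = cover_class B A'))"
    unfolding whitehead_points_def using class_covers_iff by blast
  also have "\<dots> \<longleftrightarrow> (\<forall>A'. abstractive B A' \<longrightarrow>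
      class_covers B (cover_class B A) (cover_class B A') \<longrightarrow> cover_class B A = cover_class B A')"
    using assms class_covers_iff by metis
  also have "\<dots> \<longleftrightarrow> (\<forall>A'. abstractive B A' \<longrightarrow> covers B A A' \<longrightarrow> covers B A' A)"
    using assms class_covers_iff cover_class_eq_iff unfolding cover_equiv_def by blast
  finally show ?thesis .
qed

lemma whitehead_map_iff:
  assumes A: "abstractive B A" and P: "cover_class B A \<in> whitehead_points B"
    and x: "x \<in> carrier B"
  shows "cover_class B A \<in> whitehead_map B x \<longleftrightarrow> (\<exists>a\<in>A. a \<sqsubseteq> x)"
proof
  assume "cover_class B A \<in> whitehead_map B x"
  then obtain D d where D: "abstractive B D" "cover_class B A = cover_class B D"
      and d: "d \<in> D" "d \<sqsubseteq> x"
    unfolding whitehead_map_def by blast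
  then obtain a where "a \<in> A" "a \<sqsubseteq> d"
    using A cover_class_eq_iff unfolding cover_equiv_def covers_def by meson
  with d x A D(1) show "\<exists>a\<in>A. a \<sqsubseteq> x"
    using ble_trans unfolding abstractive_def by blast
qed (use A P in \<open>auto simp: whitehead_map_def\<close>)

end

section \<open>Fields of sets with overlap as contact\<close>

definition overlap_algebra :: "'a set set \<Rightarrow> 'a set contact_alg"
  where "overlap_algebra F =
    \<lparr>carrier = F, meet = (\<inter>), join = (\<union>), compl = uminus, bzero = {}, bone = UNIV,
     contact = (\<lambda>x y. x \<inter> y \<noteq> {})\<rparr>"

lemma overlap_algebra_simps [simp]:
  "carrier (overlap_algebra F) = F"
  "x \<sqinter>\<^bsub>overlap_algebra F\<^esub> y = x \<inter> y"
  "x \<squnion>\<^bsub>overlap_algebra F\<^esub> y = x \<union> y"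
  "\<sim>\<^bsub>overlap_algebra F\<^esub> x = - x"
  "\<zero>\<^bsub>overlap_algebra F\<^esub> = {}"
  "\<one>\<^bsub>overlap_algebra F\<^esub> = UNIV"
  "x \<bowtie>\<^bsub>overlap_algebra F\<^esub> y \<longleftrightarrow> x \<inter> y \<noteq> {}"
  by (simp_all add: overlap_algebra_def)

locale field_of_sets =
  fixes F :: "'a set set"
  assumes empty_mem: "{} \<in> F"
    and Compl_mem: "x \<in> F \<Longrightarrow> - x \<in> F"
    and Un_mem: "\<lbrakk>x \<in> F; y \<in> F\<rbrakk> \<Longrightarrow> x \<union> y \<in> F"
begin

abbreviation B :: "'a set contact_alg"
  where "B \<equiv> overlap_algebra F"

lemma UNIV_mem: "UNIV \<in> F"
  using Compl_mem[OF empty_mem] by simp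

lemma Int_mem: "\<lbrakk>x \<in> F; y \<in> F\<rbrakk> \<Longrightarrow> x \<inter> y \<in> F"
  using Compl_mem[OF Un_mem[OF Compl_mem Compl_mem]] by fastforce

lemma Diff_mem: "\<lbrakk>x \<in> F; y \<in> F\<rbrakk> \<Longrightarrow> x - y \<in> F"
  by (simp add: Diff_eq Int_mem Compl_mem)

lemma ble_overlap [simp]: "x \<sqsubseteq>\<^bsub>B\<^esub> y \<longleftrightarrow> x \<subseteq> y"
  by (auto simp: ble_def)

lemma covers_overlap: "covers B A A' \<longleftrightarrow> (\<forall>x\<in>A. \<exists>y\<in>A'. y \<subseteq> x)"
  by (simp add: covers_def)

lemma abstractive_overlap:
  "abstractive B A \<longleftrightarrow> A \<subseteq> F \<and> {} \<notin> A \<and> (\<forall>u\<in>A. \<forall>v\<in>A. u \<subseteq> v \<or> v \<subseteq> u) \<and>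
    \<not> (\<exists>x\<in>A. \<forall>y\<in>A. x \<subseteq> y)"
proof -
  have "x \<lless>\<^bsub>B\<^esub> y \<longleftrightarrow> x \<subseteq> y" for x y
    by (auto simp: nontangential_def)
  then have "(u = v \<or> u \<lless>\<^bsub>B\<^esub> v \<or> v \<lless>\<^bsub>B\<^esub> u) \<longleftrightarrow> u \<subseteq> v \<or> v \<subseteq> u" for u v
    by auto
  then show ?thesis
    unfolding abstractive_def by simp
qed

sublocale boolean_contact_algebra B
  by unfold_locales
     (auto simp: ble_def empty_mem UNIV_mem Un_mem Int_mem Compl_mem)

end

section \<open>The Stone map of a field with enough Whitehead points\<close>

locale field_with_points = field_of_sets +
  assumes point_below: "\<lbrakk>x \<in> F; x \<noteq> {}\<rbrakk> \<Longrightarrow>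
    \<exists>A. abstractive B A \<and> cover_class B A \<in> whitehead_points B \<and> (\<exists>a\<in>A. a \<subseteq> x)"
begin

text \<open>
  The class of the empty abstractive set is no Whitehead point, because the empty set covers every
  abstractive set and the members of \<open>F\<close> supply nonempty ones.
\<close>

lemma whitehead_point_nonempty:
  assumes "abstractive B A" "cover_class B A \<in> whitehead_points B"
  shows "A \<noteq> {}"
proof
  assume "A = {}"
  obtain D d where "abstractive B D" "d \<in> D"
    using point_below[OF UNIV_mem] by blast
  moreover from this have "covers B D A"
    using assms \<open>A = {}\<close> whitehead_point_iff[OF assms(1)] by (simp add: covers_overlap)
  ultimately show False
    using \<open>A = {}\<close> by (auto simp: covers_overlap)
qed

text \<open>
  A Whitehead point generates an ultrafilter: if no member of \<open>A\<close> lies in \<open>- x\<close>, then \<open>A\<close>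
  covers an abstractive set having a member inside \<open>x\<close>, and minimality yields a member of \<open>A\<close>
  inside \<open>x\<close>.
\<close>

lemma whitehead_point_decides:
  assumes A: "abstractive B A" and P: "cover_class B A \<in> whitehead_points B" and x: "x \<in> F"
    and no: "\<not> (\<exists>a\<in>A. a \<subseteq> - x)"
  shows "\<exists>a\<in>A. a \<subseteq> x"
proof -
  have sub: "A \<subseteq> F" and chain: "\<forall>u\<in>A. \<forall>v\<in>A. u \<subseteq> v \<or> v \<subseteq> u"
    using A by (simp_all add: abstractive_overlap)
  let ?D = "(\<lambda>a. a \<inter> x) ` A"
  have nonempty: "{} \<notin> ?D"
    using no by (simp add: image_iff disjoint_eq_subset_Compl eq_commute[of "{}"])
  have "\<exists>D. abstractive B D \<and> covers B A D \<and> (\<exists>d\<in>D. d \<subseteq> x)"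
  proof (cases "\<exists>m\<in>?D. \<forall>y\<in>?D. m \<subseteq> y")
    case False
    have "a \<inter> x \<subseteq> b \<inter> x \<or> b \<inter> x \<subseteq> a \<inter> x" if "a \<in> A" "b \<in> A" for a b
      using chain that by (meson Int_mono subset_refl)
    then have "\<forall>u\<in>?D. \<forall>v\<in>?D. u \<subseteq> v \<or> v \<subseteq> u"
      by simp
    moreover have "?D \<subseteq> F"
      by (intro image_subsetI Int_mem x subsetD[OF sub])
    ultimately have "abstractive B ?D"
      using False nonempty unfolding abstractive_overlap by (intro conjI)
    moreover have "covers B A ?D"
      unfolding covers_overlap by simp (meson Int_lower1)
    moreover have "\<exists>d\<in>?D. d \<subseteq> x"
      using whitehead_point_nonempty[OF A P] by auto
    ultimately show ?thesis
      by (intro exI conjI)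
  next
    case True
    \<comment> \<open>The trace of \<open>A\<close> on \<open>x\<close> is not abstractive, but a point below its least element serves
      instead.\<close>
    then obtain a where a: "a \<in> A" "\<forall>b\<in>A. a \<inter> x \<subseteq> b \<inter> x"
      by (simp only: bex_simps ball_simps) (elim bexE)
    have "a \<inter> x \<in> F" "a \<inter> x \<noteq> {}"
      using a(1) sub x Int_mem nonempty by (blast, metis image_eqI)
    then obtain D d where D: "abstractive B D" "d \<in> D" "d \<subseteq> a \<inter> x"
      by (meson point_below)
    moreover have "covers B A D"
      unfolding covers_overlap using a(2) D(2,3) by (meson Int_lower1 subset_trans)
    moreover have "d \<subseteq> x"
      using D(3) by simp
    ultimately show ?thesis
      by (intro exI conjI bexI)
  qed
  then obtain D d where "abstractive B D" "covers B A D" and d: "d \<in> D" "d \<subseteq> x"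
    by (elim exE conjE bexE)
  then have "covers B D A"
    using iffD1[OF whitehead_point_iff[OF A] P] by simp
  then obtain a where "a \<in> A" "a \<subseteq> d"
    using d(1) unfolding covers_overlap by (elim ballE[of _ _ d] bexE) simp_all
  with d(2) show ?thesis
    by (meson subset_trans)
qed

lemma mem_whitehead_map:
  assumes "abstractive B A" "cover_class B A \<in> whitehead_points B" "x \<in> F"
  shows "cover_class B A \<in> whitehead_map B x \<longleftrightarrow> (\<exists>a\<in>A. a \<subseteq> x)"
  using whitehead_map_iff[OF assms(1,2)] assms(3) by simp

lemma whitehead_map_subset: "whitehead_map B x \<subseteq> whitehead_points B"
  unfolding whitehead_map_def by blast

lemma whitehead_points_eqI:
  assumes "P \<subseteq> whitehead_points B" "Q \<subseteq> whitehead_points B"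
    and "\<And>A. \<lbrakk>abstractive B A; cover_class B A \<in> whitehead_points B\<rbrakk> \<Longrightarrow>
      cover_class B A \<in> P \<longleftrightarrow> cover_class B A \<in> Q"
  shows "P = Q"
proof -
  have "\<exists>A. abstractive B A \<and> p = cover_class B A" if "p \<in> whitehead_points B" for p
    using that unfolding whitehead_points_def by blast
  with assms show ?thesis
    by blast
qed

lemma whitehead_map_empty: "whitehead_map B {} = {}"
  by (rule whitehead_points_eqI[OF whitehead_map_subset])
     (auto simp: mem_whitehead_map empty_mem abstractive_overlap)

lemma whitehead_map_nonempty:
  assumes "x \<in> F" "x \<noteq> {}"
  shows "whitehead_map B x \<noteq> {}"
  using point_below[OF assms] mem_whitehead_map assms(1) by blast

lemma whitehead_map_Int:
  assumes "x \<in> F" "y \<in> F"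
  shows "whitehead_map B (x \<inter> y) = whitehead_map B x \<inter> whitehead_map B y"
proof (rule whitehead_points_eqI)
  fix A assume A: "abstractive B A" "cover_class B A \<in> whitehead_points B"
  have "(\<exists>a\<in>A. a \<subseteq> x \<inter> y) \<longleftrightarrow> (\<exists>a\<in>A. a \<subseteq> x) \<and> (\<exists>a\<in>A. a \<subseteq> y)"
    using A(1) unfolding abstractive_overlap by (meson Int_greatest le_infE subset_trans)
  then show "cover_class B A \<in> whitehead_map B (x \<inter> y) \<longleftrightarrow>
      cover_class B A \<in> whitehead_map B x \<inter> whitehead_map B y"
    using A assms by (simp add: mem_whitehead_map Int_mem)
qed (use whitehead_map_subset in blast)+

lemma whitehead_map_Compl:
  assumes "x \<in> F"
  shows "whitehead_map B (- x) = whitehead_points B - whitehead_map B x"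
proof -
  have "whitehead_map B (- x) \<inter> whitehead_map B x = {}"
    using whitehead_map_Int[OF Compl_mem[OF assms] assms] whitehead_map_empty by simp
  moreover have "whitehead_map B (- x) \<union> whitehead_map B x = whitehead_points B"
    by (rule whitehead_points_eqI)
       (use whitehead_map_subset whitehead_point_decides assms Compl_mem mem_whitehead_map
         in \<open>blast+\<close>)
  ultimately show ?thesis
    by blast
qed

lemma whitehead_map_UNIV: "whitehead_map B UNIV = whitehead_points B"
  using whitehead_map_Compl[OF empty_mem] by (simp add: whitehead_map_empty)

lemma whitehead_map_Un:
  assumes "x \<in> F" "y \<in> F"
  shows "whitehead_map B (x \<union> y) = whitehead_map B x \<union> whitehead_map B y"
proof -
  have "whitehead_map B (x \<union> y) = whitehead_map B (- (- x \<inter> - y))"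
    by simp
  also have "\<dots> = whitehead_points B - (whitehead_points B - whitehead_map B x) \<inter>
      (whitehead_points B - whitehead_map B y)"
    by (simp only: whitehead_map_Compl whitehead_map_Int Int_mem Compl_mem assms)
  finally show ?thesis
    using whitehead_map_subset by blast
qed

lemma inj_on_whitehead_map: "inj_on (whitehead_map B) F"
proof -
  have "x \<subseteq> y" if x: "x \<in> F" and y: "y \<in> F" and eq: "whitehead_map B x = whitehead_map B y" for x y
  proof -
    have "whitehead_map B (x - y) = whitehead_map B x \<inter> (whitehead_points B - whitehead_map B y)"
      using x y by (simp add: Diff_eq whitehead_map_Int whitehead_map_Compl Compl_mem)
    then have "whitehead_map B (x - y) = {}"
      using eq by blast
    then show ?thesis
      using whitehead_map_nonempty[OF Diff_mem[OF x y]] by blast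
  qed
  then show ?thesis
    by (auto simp: inj_on_def)
qed

abbreviation T :: "'a set set set topology"
  where "T \<equiv> discrete_topology (whitehead_points B)"

lemma closure_of_whitehead_map: "T closure_of whitehead_map B x = whitehead_map B x"
  using whitehead_map_subset by (auto simp: closure_of_def)

lemma whitehead_map_hom: "whitehead_map B \<in> bool_hom B (regular_open_algebra T)"
proof -
  have clos: "T closure_of P = P" and int: "T interior_of P = P"
    if "P \<subseteq> whitehead_points B" for P
    using that by (auto simp: closure_of_def interior_of_def)
  have sub: "whitehead_map B x \<union> whitehead_map B y \<subseteq> whitehead_points B" for x y
    using whitehead_map_subset by blast
  have "regular_openin T (whitehead_map B x)" for x
    by (simp only: regular_openin_def clos int whitehead_map_subset)
  then show ?thesis
    by (simp add: bool_hom_def regular_open_algebra_def whitehead_map_Int whitehead_map_Un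
        whitehead_map_Compl whitehead_map_empty whitehead_map_UNIV clos[OF sub] int[OF sub]
        int[OF Diff_subset] del: closure_of_Un discrete_topology_interior_of)
qed

lemma contact_iff_whitehead_map_meet:
  assumes "x \<in> F" "y \<in> F"
  shows "x \<bowtie>\<^bsub>B\<^esub> y \<longleftrightarrow> whitehead_map B x \<inter> whitehead_map B y \<noteq> {}"
proof -
  have "x \<inter> y \<noteq> {} \<longleftrightarrow> whitehead_map B (x \<inter> y) \<noteq> {}"
    using whitehead_map_nonempty[OF Int_mem[OF assms]] whitehead_map_empty by auto
  then show ?thesis
    by (simp add: whitehead_map_Int assms)
qed

end

section \<open>Clopen sets of the Sorgenfrey line\<close>

definition sorgenfrey_clopen :: "real set set"
  where "sorgenfrey_clopen = {S. \<forall>p. \<forall>\<^sub>F q in at_right p. q \<in> S \<longleftrightarrow> p \<in> S}"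

interpretation sorgenfrey: field_of_sets sorgenfrey_clopen
proof
  fix S S' assume S: "S \<in> sorgenfrey_clopen" "S' \<in> sorgenfrey_clopen"
  have "\<forall>\<^sub>F q in at_right p. q \<in> S \<union> S' \<longleftrightarrow> p \<in> S \<union> S'" for p
  proof -
    have "\<forall>\<^sub>F q in at_right p. q \<in> S \<longleftrightarrow> p \<in> S" "\<forall>\<^sub>F q in at_right p. q \<in> S' \<longleftrightarrow> p \<in> S'"
      using S by (simp_all add: sorgenfrey_clopen_def)
    then show ?thesis
      by eventually_elim simp
  qed
  then show "S \<union> S' \<in> sorgenfrey_clopen"
    by (simp add: sorgenfrey_clopen_def)
qed (auto simp: sorgenfrey_clopen_def)

lemma sorgenfrey_clopen_decided:
  assumes "S \<in> sorgenfrey_clopen"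
  obtains q where "q > p" "p \<in> S \<Longrightarrow> {p..<q} \<subseteq> S" "p \<notin> S \<Longrightarrow> {p..<q} \<inter> S = {}"
proof -
  obtain q where q: "q > p" "\<And>y. \<lbrakk>p < y; y < q\<rbrakk> \<Longrightarrow> y \<in> S \<longleftrightarrow> p \<in> S"
    using assms unfolding sorgenfrey_clopen_def eventually_at_right_field by blast
  then have "y \<in> S \<longleftrightarrow> p \<in> S" if "y \<in> {p..<q}" for y
    using that by (cases "y = p") auto
  with q(1) that show ?thesis
    by blast
qed

lemma half_open_interval_clopen: "{a..<b} \<in> sorgenfrey_clopen"
proof -
  have "\<exists>c>p. \<forall>y>p. y < c \<longrightarrow> (y \<in> {a..<b} \<longleftrightarrow> p \<in> {a..<b})" for p
  proof -
    \<comment> \<open>The nearest endpoint to the right of \<open>p\<close>.\<close>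
    define c where "c = (if p < a then a else if p < b then b else p + 1)"
    have "p < c \<and> (\<forall>y>p. y < c \<longrightarrow> (y \<in> {a..<b} \<longleftrightarrow> p \<in> {a..<b}))"
      by (auto simp: c_def)
    then show ?thesis
      by blast
  qed
  then show ?thesis
    by (simp add: sorgenfrey_clopen_def eventually_at_right_field)
qed

definition right_germ :: "real \<Rightarrow> real set set"
  where "right_germ p = (\<lambda>q. {p..<q}) ` {p<..}"

lemma right_germ_abstractive: "abstractive sorgenfrey.B (right_germ p)"
proof -
  have "\<not> (\<forall>y\<in>right_germ p. {p..<q} \<subseteq> y)" if q: "q > p" for q
  proof -
    obtain r where r: "p < r" "r < q"
      using dense[OF q] by blast
    then have "r \<in> {p..<q} - {p..<r}"
      by simp
    with r(1) show ?thesis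
      unfolding right_germ_def by blast
  qed
  then have "\<not> (\<exists>x\<in>right_germ p. \<forall>y\<in>right_germ p. x \<subseteq> y)"
    unfolding right_germ_def by blast
  moreover have "{p..<q} \<subseteq> {p..<r} \<or> {p..<r} \<subseteq> {p..<q}" for q r
    by (cases "q \<le> r") auto
  then have "\<forall>u\<in>right_germ p. \<forall>v\<in>right_germ p. u \<subseteq> v \<or> v \<subseteq> u"
    unfolding right_germ_def by blast
  moreover have "right_germ p \<subseteq> sorgenfrey_clopen" "{} \<notin> right_germ p"
    by (auto simp: right_germ_def half_open_interval_clopen)
  ultimately show ?thesis
    unfolding sorgenfrey.abstractive_overlap by blast
qed

text \<open>
  Let the germ cover \<open>A\<close>. A member of \<open>A\<close> missing some interval \<open>{p..<q}\<close> would be disjoint from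
  the nonempty member of \<open>A\<close> inside that interval, although \<open>A\<close> is a chain. So every member of
  \<open>A\<close> contains such an interval.
\<close>

lemma right_germ_whitehead_point:
  "cover_class sorgenfrey.B (right_germ p) \<in> whitehead_points sorgenfrey.B"
proof -
  have "covers sorgenfrey.B A (right_germ p)"
    if A: "abstractive sorgenfrey.B A" and cov: "covers sorgenfrey.B (right_germ p) A" for A
    unfolding sorgenfrey.covers_overlap
  proof
    fix S assume S: "S \<in> A"
    then have "S \<in> sorgenfrey_clopen"
      using A unfolding sorgenfrey.abstractive_overlap by blast
    then obtain q where q: "q > p" "p \<in> S \<Longrightarrow> {p..<q} \<subseteq> S" "p \<notin> S \<Longrightarrow> {p..<q} \<inter> S = {}"
      using sorgenfrey_clopen_decided by blast
    then have germ: "{p..<q} \<in> right_germ p"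
      unfolding right_germ_def by simp
    then obtain S' where S': "S' \<in> A" "S' \<subseteq> {p..<q}"
      using cov unfolding sorgenfrey.covers_overlap by blast
    have "S \<subseteq> S' \<or> S' \<subseteq> S" "S \<noteq> {}" "S' \<noteq> {}"
      using A S S'(1) unfolding sorgenfrey.abstractive_overlap by blast+
    then have "{p..<q} \<inter> S \<noteq> {}"
      using S'(2) by blast
    with q germ show "\<exists>y\<in>right_germ p. y \<subseteq> S"
      by blast
  qed
  then show ?thesis
    using sorgenfrey.whitehead_point_iff[OF right_germ_abstractive] by blast
qed

interpretation sorgenfrey: field_with_points sorgenfrey_clopen
proof
  fix S :: "real set" assume S: "S \<in> sorgenfrey_clopen" "S \<noteq> {}"
  then obtain p q where "q > p" "{p..<q} \<subseteq> S"
    by (metis sorgenfrey_clopen_decided ex_in_conv)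
  then have "\<exists>a\<in>right_germ p. a \<subseteq> S"
    unfolding right_germ_def by blast
  then show "\<exists>A. abstractive sorgenfrey.B A \<and>
      cover_class sorgenfrey.B A \<in> whitehead_points sorgenfrey.B \<and> (\<exists>a\<in>A. a \<subseteq> S)"
    using right_germ_abstractive right_germ_whitehead_point by blast
qed

theorem corollary1:
  shows "\<exists>(B :: real set contact_alg) (T :: real set set set topology).
    boolean_contact_algebra B \<and>
    \<zero>\<^bsub>B\<^esub> \<noteq> \<one>\<^bsub>B\<^esub> \<and>
    topspace T = whitehead_points B \<and>
    whitehead_map B \<in> bool_hom B (regular_open_algebra T) \<and>
    inj_on (whitehead_map B) (carrier B) \<and>
    (\<forall>x\<in>carrier B. \<forall>y\<in>carrier B. x \<bowtie>\<^bsub>B\<^esub> y \<longleftrightarrow>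
      (T closure_of whitehead_map B x) \<inter> (T closure_of whitehead_map B y) \<noteq> {})"
proof (intro exI conjI ballI)
  show "boolean_contact_algebra sorgenfrey.B"
    by (rule sorgenfrey.boolean_contact_algebra_axioms)
  show "\<zero>\<^bsub>sorgenfrey.B\<^esub> \<noteq> \<one>\<^bsub>sorgenfrey.B\<^esub>"
    by simp
  show "topspace sorgenfrey.T = whitehead_points sorgenfrey.B"
    by simp
  show "whitehead_map sorgenfrey.B \<in> bool_hom sorgenfrey.B (regular_open_algebra sorgenfrey.T)"
    by (rule sorgenfrey.whitehead_map_hom)
  show "inj_on (whitehead_map sorgenfrey.B) (carrier sorgenfrey.B)"
    unfolding overlap_algebra_simps by (rule sorgenfrey.inj_on_whitehead_map)
  fix x y assume "x \<in> carrier sorgenfrey.B" "y \<in> carrier sorgenfrey.B"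
  then show "x \<bowtie>\<^bsub>sorgenfrey.B\<^esub> y \<longleftrightarrow> (sorgenfrey.T closure_of whitehead_map sorgenfrey.B x) \<inter>
      (sorgenfrey.T closure_of whitehead_map sorgenfrey.B y) \<noteq> {}"
    unfolding overlap_algebra_simps(1) sorgenfrey.closure_of_whitehead_map
    by (rule sorgenfrey.contact_iff_whitehead_map_meet)
qed

end
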